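(* In the setting of the context, assume $V^{LQ}\in C^{1,2}$. Then the expected present value of future dividends $V^{LQ}$ satisfies the partial differential equation $$V^{LQ}_t(t,x)=\tilde\delta V^{LQ}(t,x)-l_0-p(t)-\big(l_1+2q(t)\big)x-V^{LQ}_x(t,x)\Big(c-l_0-p(t)-\big(l_1+2q(t)\big)x\Big)-\tfrac12V^{LQ}_{xx}(t,x)\varsigma^2,$$ $$V^{LQ}(T,x)=0 .$$ Conversely, if a function satisfies this partial differential equation (with its terminal condition), it is indeed the expected present value of future dividends $V^{LQ}$.
   Context: Let $T\ge0$, let $W$ be a Brownian motion, and let $c,\varsigma,\delta,\tilde\delta,\kappa,x_T$ and the benchmark coefficients $l_0,l_1,x_0$ be constants; let $\gamma$ be a weight function on $[0,T]$, $\Delta\Gamma(T)\ge0$ and $\tau\in\{0,1,2\}$. Let $q,p$ solve $$q_t=\delta q+2q^2-\tfrac12\gamma+2q\,l_1,\qquad p_t=\delta p+\gamma x_0-2qc+2q\,l_0+p\,l_1+2qp,$$ with terminal conditions: for $\tau=0$, $q(T)=\Delta\Gamma(T)$, $p(T)=-2\Delta\Gamma(T)x_0$; for $\tau=1$, $q(T)=\Delta\Gamma(T)$, $p(T)=-2\Delta\Gamma(T)x_0+\kappa$; for $\tau=2$, $q(T)=\Delta\Gamma(T)+\kappa$, $p(T)=-2\Delta\Gamma(T)x_0-2\kappa x_T$. These functions determine the dividend rate $l^*(t,x)=l_0+p(t)+(l_1+2q(t))x$, the optimal strategy in a linear-quadratic dividend problem with continuous dividend payments and no jumps. The surplus under this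 strategy has dynamics $$dX(t)=\big(c-l_0-p(t)\big)dt-\big(l_1+2q(t)\big)X(t)\,dt+\varsigma\,dW(t),$$ and the expected present value of future dividends up to time $T$, with discount (impatience) factor $\tilde\delta$, is $$V^{LQ}(t,x)=\mathbb{E}_{t,x}\Big[\int_t^Te^{-\tilde\delta(s-t)}\Big(l_0+p(s)+\big(l_1+2q(s)\big)X(s)\Big)ds\Big],$$ where $\mathbb{E}_{t,x}$ is expectation conditional on $X(t)=x$. Subscripts $t,x$ denote partial derivatives.
   Formalization: In the converse, when ς ≠ 0, the function v is also required to satisfy |v(t,x)| ≤ A exp(a x²) on [0,T]×ℝ for some constants A, a; without a growth condition the converse is false (Tychonoff null solutions of the heat equation). *)

theory Defs
  imports "HOL-Probability.Probability"
begin

definition brownian_motion :: "'a measure \<Rightarrow> (real \<Rightarrow> 'a \<Rightarrow> real) \<Rightarrow> bool" where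
  "brownian_motion M W \<longleftrightarrow>
     prob_space M \<and>
     (\<forall>t\<ge>0. W t \<in> borel_measurable M) \<and>
     (AE \<omega> in M. W 0 \<omega> = 0) \<and>
     (\<forall>s\<ge>0. \<forall>t>s. distributed M lborel (\<lambda>\<omega>. W t \<omega> - W s \<omega>) (normal_density 0 (sqrt (t - s)))) \<and>
     (\<forall>(n::nat) r. 0 \<le> r 0 \<and> (\<forall>i<n. r i < r (Suc i)) \<longrightarrow>
        prob_space.indep_vars M (\<lambda>_. borel) (\<lambda>i \<omega>. W (r (Suc i)) \<omega> - W (r i) \<omega>) {..<n}) \<and>
     (AE \<omega> in M. continuous_on {0..} (\<lambda>t. W t \<omega>))"

text \<open>
  \<open>Y\<close> solves \<open>dX(s) = (c - l0 - p(s)) ds - (l1 + 2 q(s)) X(s) ds + \<sigma> dW(s)\<close> on \<open>[t, T]\<close> with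
  \<open>X(t) = x\<close>. The diffusion coefficient is constant, so the stochastic integral of \<open>\<sigma>\<close> over
  \<open>[t, s]\<close> is \<open>\<sigma> (W(s) - W(t))\<close> and the equation is an ordinary integral equation along
  almost every path. Continuity is required of every path because \<open>M\<close> need not be complete:
  it makes time integrals of \<open>Y\<close> measurable.
\<close>

definition surplus_solution ::
  "'a measure \<Rightarrow> (real \<Rightarrow> 'a \<Rightarrow> real) \<Rightarrow> real \<Rightarrow> real \<Rightarrow> real \<Rightarrow> real \<Rightarrow> real \<Rightarrow>
   (real \<Rightarrow> real) \<Rightarrow> (real \<Rightarrow> real) \<Rightarrow> real \<Rightarrow> real \<Rightarrow> (real \<Rightarrow> 'a \<Rightarrow> real) \<Rightarrow> bool" where
  "surplus_solution M W T c \<sigma> l0 l1 q p t x Y \<longleftrightarrow>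
     (\<forall>s\<in>{t..T}. Y s \<in> borel_measurable M) \<and>
     (\<forall>\<omega>\<in>space M. continuous_on {t..T} (\<lambda>s. Y s \<omega>)) \<and>
     (AE \<omega> in M. \<forall>s\<in>{t..T}.
        Y s \<omega> = x + integral {t..s} (\<lambda>u. (c - l0 - p u) - (l1 + 2 * q u) * Y u \<omega>)
                  + \<sigma> * (W s \<omega> - W t \<omega>))"

text \<open>
  \<open>X t x\<close> is the surplus process started at time \<open>t\<close> in \<open>x\<close>, so that the expectation
  conditional on \<open>X(t) = x\<close> is the plain expectation of a functional of \<open>X t x\<close>.
\<close>

definition VLQ ::
  "'a measure \<Rightarrow> (real \<Rightarrow> real \<Rightarrow> real \<Rightarrow> 'a \<Rightarrow> real) \<Rightarrow> real \<Rightarrow> real \<Rightarrow> real \<Rightarrow> real \<Rightarrow>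
   (real \<Rightarrow> real) \<Rightarrow> (real \<Rightarrow> real) \<Rightarrow> real \<Rightarrow> real \<Rightarrow> real" where
  "VLQ M X T \<delta>' l0 l1 q p t x =
     (\<integral>\<omega>. integral {t..T}
        (\<lambda>s. exp (- \<delta>' * (s - t)) * (l0 + p s + (l1 + 2 * q s) * X t x s \<omega>)) \<partial>M)"

text \<open>The time derivative is relative to \<open>[0, T]\<close>, hence one-sided at \<open>t = 0\<close>.\<close>

definition D_t :: "real \<Rightarrow> (real \<Rightarrow> real \<Rightarrow> real) \<Rightarrow> real \<Rightarrow> real \<Rightarrow> real" where
  "D_t T v t x = vector_derivative (\<lambda>s. v s x) (at t within {0..T})"

definition D_x :: "(real \<Rightarrow> real \<Rightarrow> real) \<Rightarrow> real \<Rightarrow> real \<Rightarrow> real" where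
  "D_x v t x = deriv (\<lambda>y. v t y) x"

definition D_xx :: "(real \<Rightarrow> real \<Rightarrow> real) \<Rightarrow> real \<Rightarrow> real \<Rightarrow> real" where
  "D_xx v t x = deriv (\<lambda>y. D_x v t y) x"

text \<open>
  \<open>C\<^sup>1\<^sup>,\<^sup>2\<close> on \<open>[0, T) \<times> \<real>\<close>, and continuous up to the terminal time.
\<close>

definition C12 :: "real \<Rightarrow> (real \<Rightarrow> real \<Rightarrow> real) \<Rightarrow> bool" where
  "C12 T v \<longleftrightarrow>
     continuous_on ({0..T} \<times> UNIV) (\<lambda>(t, x). v t x) \<and>
     (\<forall>t\<in>{0..<T}. \<forall>x.
        (\<lambda>s. v s x) differentiable (at t within {0..T}) \<and>
        (\<lambda>y. v t y) differentiable (at x) \<and>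
        (\<lambda>y. D_x v t y) differentiable (at x)) \<and>
     continuous_on ({0..<T} \<times> UNIV) (\<lambda>(t, x). D_t T v t x) \<and>
     continuous_on ({0..<T} \<times> UNIV) (\<lambda>(t, x). D_x v t x) \<and>
     continuous_on ({0..<T} \<times> UNIV) (\<lambda>(t, x). D_xx v t x)"

definition satisfies_pde ::
  "real \<Rightarrow> real \<Rightarrow> real \<Rightarrow> real \<Rightarrow> real \<Rightarrow> real \<Rightarrow>
   (real \<Rightarrow> real) \<Rightarrow> (real \<Rightarrow> real) \<Rightarrow> (real \<Rightarrow> real \<Rightarrow> real) \<Rightarrow> bool" where
  "satisfies_pde T \<delta>' c \<sigma> l0 l1 q p v \<longleftrightarrow>
     (\<forall>t\<in>{0..<T}. \<forall>x.
        D_t T v t x = \<delta>' * v t x - l0 - p t - (l1 + 2 * q t) * x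
          - D_x v t x * (c - l0 - p t - (l1 + 2 * q t) * x)
          - 1 / 2 * D_xx v t x * \<sigma>\<^sup>2) \<and>
     (\<forall>x. v T x = 0)"

text \<open>
  Uniqueness class for the parabolic equation. When the diffusion coefficient is nonzero, some
  growth restriction at infinity is indispensable: Tychonoff's null solutions of the heat
  equation are smooth, nonzero, and vanish at the terminal time. The bound, uniform in time, is
  the classical one and includes all functions of polynomial growth. Without diffusion, nothing
  is required.
\<close>

definition tychonoff_class :: "real \<Rightarrow> real \<Rightarrow> (real \<Rightarrow> real \<Rightarrow> real) \<Rightarrow> bool" where
  "tychonoff_class T \<sigma> v \<longleftrightarrow>
     (\<sigma> \<noteq> 0 \<longrightarrow> (\<exists>A a. \<forall>t\<in>{0..T}. \<forall>x. \<bar>v t x\<bar> \<le> A * exp (a * x\<^sup>2)))"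

end

theory Submission
  imports Defs
begin

text \<open>
  The surplus is linear in its starting value and driven by additive noise, so the expected present
  value of dividends is affine in \<open>x\<close>: \<open>V t x = A t + B t * x\<close>. Write \<open>b = l1 + 2 q\<close> for the slope of the
  dividend rate. Inserting this form into the partial differential equation shows what the
  coefficients have to be, namely the solutions of
  \<open>B' = \<delta>' B - b + b B\<close> and \<open>A' = \<delta>' A - (l0 + p) - (c - l0 - p) B\<close> with terminal value \<open>0\<close>.

  That the expectation is this affine function is shown path by path
  (\<open>pathwise_dividend_identity\<close>): the fundamental theorem of calculus writes the present value of the
  dividends as \<open>A t + B t * x\<close> plus the time integral of a deterministic multiple of the Brownian
  increment \<open>W s - W t\<close>. By Fubini's theorem the latter has mean zero
  (\<open>expected_dividends_affine\<close>). The first half of the proposition is then a computation with an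
  explicit function.

  The converse is a uniqueness statement, and so purely analytic. Discounting the difference of a
  solution and the affine one gives a function \<open>z\<close> with zero terminal value and
  \<open>z\<^sub>t + (a - b x) z\<^sub>x + \<sigma>\<^sup>2 z\<^sub>x\<^sub>x / 2 = 0\<close>, where \<open>a = c - l0 - p\<close>. If \<open>\<sigma> = 0\<close>, it is constant along
  characteristics (\<open>transport_uniqueness\<close>). If \<open>\<sigma> \<noteq> 0\<close>, the growth condition allows a comparison, by
  the maximum principle, with arbitrarily small multiples of a Gaussian barrier that is a strict
  supersolution on short time intervals (\<open>barrier_upper_bound\<close>); going backwards from \<open>T\<close> in short
  steps covers all times (\<open>tychonoff_uniqueness\<close>).
\<close>

section \<open>Linear differential equations\<close>

lemma linear_ode_solution:
  fixes f g :: "real \<Rightarrow> real"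
  assumes f: "continuous_on {a..b} f" and g: "continuous_on {a..b} g" and t0: "t0 \<in> {a..b}"
  obtains y where "y t0 = y0"
    "\<And>t. t \<in> {a..b} \<Longrightarrow> (y has_real_derivative f t * y t + g t) (at t within {a..b})"
proof -
  obtain F where F: "\<And>t. t \<in> {a..b} \<Longrightarrow> (F has_real_derivative f t) (at t within {a..b})"
    using antiderivative_continuous[OF f]
    by (auto simp: has_real_derivative_iff_has_vector_derivative)
  have contF: "continuous_on {a..b} F"
    using F by (meson DERIV_continuous continuous_on_eq_continuous_within)
  have "continuous_on {a..b} (\<lambda>s. exp (- F s) * g s)"
    by (intro continuous_intros contF g)
  then obtain H where H:
    "\<And>t. t \<in> {a..b} \<Longrightarrow> (H has_real_derivative exp (- F t) * g t) (at t within {a..b})"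
    by (rule antiderivative_continuous) (auto simp: has_real_derivative_iff_has_vector_derivative)
  define y where "y t = exp (F t) * (H t - H t0 + exp (- F t0) * y0)" for t
  show thesis
  proof (rule that)
    show "y t0 = y0" by (simp add: y_def flip: exp_add mult.assoc)
    fix t assume t: "t \<in> {a..b}"
    have "exp (F t) * (exp (- F t) * g t) = g t" by (simp flip: exp_add mult.assoc)
    then show "(y has_real_derivative f t * y t + g t) (at t within {a..b})"
      unfolding y_def
      by (auto intro!: derivative_eq_intros F[OF t] H[OF t] simp: algebra_simps)
  qed
qed

section \<open>Time integrals of continuous processes\<close>

text \<open>
  Fubini's theorem needs measurability in time and chance together. Freezing the time at the grid
  points \<open>\<lfloor>s (n + 1)\<rfloor> / (n + 1)\<close> gives countably many measurable pieces, and path continuity makes these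
  step processes converge pointwise.
\<close>

lemma continuous_process_jointly_measurable:
  fixes Y :: "real \<Rightarrow> 'a \<Rightarrow> real"
  assumes meas[measurable]: "\<And>s. Y s \<in> borel_measurable M"
    and cont: "\<And>\<omega>. \<omega> \<in> space M \<Longrightarrow> continuous_on UNIV (\<lambda>s. Y s \<omega>)"
  shows "(\<lambda>(s, \<omega>). Y s \<omega>) \<in> borel_measurable (borel \<Otimes>\<^sub>M M)"
proof (rule borel_measurable_LIMSEQ_real)
  let ?g = "\<lambda>n (s::real). real_of_int \<lfloor>s * Suc n\<rfloor> / Suc n"
  show "(\<lambda>z. Y (?g n (fst z)) (snd z)) \<in> borel_measurable (borel \<Otimes>\<^sub>M M)" for n
  proof -
    have "(\<lambda>z. Y (real_of_int i / Suc n) (snd z)) \<in> borel_measurable ((borel :: real measure) \<Otimes>\<^sub>M M)" for i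
      by (rule measurable_compose[OF measurable_snd meas])
    moreover have "(\<lambda>z. \<lfloor>fst z * Suc n\<rfloor>) \<in> measurable ((borel :: real measure) \<Otimes>\<^sub>M M) (count_space UNIV)"
      by measurable
    ultimately show ?thesis by (rule measurable_compose_countable)
  qed
  fix z assume "z \<in> space ((borel :: real measure) \<Otimes>\<^sub>M M)"
  then obtain s \<omega> where z: "z = (s, \<omega>)" and \<omega>: "\<omega> \<in> space M"
    by (auto simp: space_pair_measure)
  have "(\<lambda>n. ?g n s) \<longlonglongrightarrow> s"
  proof (rule LIMSEQ_I)
    fix r :: real assume "0 < r"
    then obtain N where N: "inverse (real (Suc N)) < r" using reals_Archimedean by blast
    have "norm (?g n s - s) < r" if "N \<le> n" for n
    proof -
      have "?g n s - s = (\<lfloor>s * Suc n\<rfloor> - s * Suc n) / Suc n"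
        by (simp add: field_simps del: of_nat_Suc)
      moreover have "\<bar>\<lfloor>s * Suc n\<rfloor> - s * Suc n\<bar> \<le> 1" by linarith
      ultimately have "norm (?g n s - s) \<le> 1 / Suc n"
        by (simp add: abs_divide divide_right_mono del: of_nat_Suc)
      also have "\<dots> \<le> inverse (real (Suc N))"
        using that by (simp add: field_simps)
      finally show ?thesis using N by simp
    qed
    then show "\<exists>no. \<forall>n\<ge>no. norm (?g n s - s) < r" by blast
  qed
  moreover have "isCont (\<lambda>s. Y s \<omega>) s"
    using cont[OF \<omega>] by (simp add: continuous_on_eq_continuous_at)
  ultimately show "(\<lambda>n. Y (?g n (fst z)) (snd z)) \<longlonglongrightarrow> (case z of (s, \<omega>) \<Rightarrow> Y s \<omega>)"
    unfolding z by (auto intro: isCont_tendsto_compose)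
qed

context
  fixes M :: "'a measure" and Y :: "real \<Rightarrow> 'a \<Rightarrow> real" and a b :: real
  assumes ab: "a \<le> b"
    and meas: "\<And>s. s \<in> {a..b} \<Longrightarrow> Y s \<in> borel_measurable M"
    and cont: "\<And>\<omega>. \<omega> \<in> space M \<Longrightarrow> continuous_on {a..b} (\<lambda>s. Y s \<omega>)"
begin

text \<open>
  The process is continuous on \<open>[a, b]\<close> only. Stopping the clock at both ends extends it to a
  continuous process on the whole line, which the indicator then cuts off again.
\<close>

lemma clamped_process_jointly_measurable:
  "(\<lambda>(s, \<omega>). indicator {a..b} s * Y (max a (min b s)) \<omega>) \<in> borel_measurable (lborel \<Otimes>\<^sub>M M)"
proof -
  have "(\<lambda>(s, \<omega>). Y (max a (min b s)) \<omega>) \<in> borel_measurable (borel \<Otimes>\<^sub>M M)"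
  proof (rule continuous_process_jointly_measurable)
    show "Y (max a (min b s)) \<in> borel_measurable M" for s
      using ab by (intro meas) auto
    show "continuous_on UNIV (\<lambda>s. Y (max a (min b s)) \<omega>)" if "\<omega> \<in> space M" for \<omega>
      by (rule continuous_on_compose2[OF cont[OF that]]) (use ab in \<open>auto intro!: continuous_intros\<close>)
  qed
  then have [measurable]: "(\<lambda>z. Y (max a (min b (fst z))) (snd z)) \<in> borel_measurable (borel \<Otimes>\<^sub>M M)"
    by (simp add: case_prod_beta')
  have "(\<lambda>z. indicator {a..b} (fst z) * Y (max a (min b (fst z))) (snd z))
      \<in> borel_measurable (borel \<Otimes>\<^sub>M M)"
    by measurable
  then show ?thesis by (simp add: case_prod_beta')
qed

lemma time_integral_eq_lebesgue:
  assumes "\<omega> \<in> space M"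
  shows "integral {a..b} (\<lambda>s. Y s \<omega>) = (\<integral>s. indicator {a..b} s * Y (max a (min b s)) \<omega> \<partial>lborel)"
proof -
  have "set_integrable lborel {a..b} (\<lambda>s. Y s \<omega>)"
    by (intro borel_integrable_atLeastAtMost' cont assms)
  then have "integral {a..b} (\<lambda>s. Y s \<omega>) = (LINT s:{a..b}|lborel. Y s \<omega>)"
    by (simp add: set_borel_integral_eq_integral)
  also have "\<dots> = (\<integral>s. indicator {a..b} s * Y (max a (min b s)) \<omega> \<partial>lborel)"
    unfolding set_lebesgue_integral_def
    by (intro Bochner_Integration.integral_cong) (auto simp: indicator_def)
  finally show ?thesis .
qed

lemma time_integral_measurable:
  assumes "sigma_finite_measure M"
  shows "(\<lambda>\<omega>. integral {a..b} (\<lambda>s. Y s \<omega>)) \<in> borel_measurable M"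
proof -
  interpret pair_sigma_finite M lborel
    using assms by (simp add: pair_sigma_finite_def lborel.sigma_finite_measure_axioms)
  have "(\<lambda>(\<omega>, s). indicator {a..b} s * Y (max a (min b s)) \<omega>) \<in> borel_measurable (M \<Otimes>\<^sub>M lborel)"
    using measurable_pair_swap[OF clamped_process_jointly_measurable]
    by (simp add: case_prod_beta' split_def)
  then have "(\<lambda>\<omega>. \<integral>s. indicator {a..b} s * Y (max a (min b s)) \<omega> \<partial>lborel) \<in> borel_measurable M"
    by (rule lborel.borel_measurable_lebesgue_integral)
  then show ?thesis
    by (subst measurable_cong[OF time_integral_eq_lebesgue])
qed

lemma time_integral_mean_zero:
  assumes "sigma_finite_measure M"
    and int: "\<And>s. s \<in> {a..b} \<Longrightarrow> integrable M (Y s)"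
    and mean: "\<And>s. s \<in> {a..b} \<Longrightarrow> (\<integral>\<omega>. Y s \<omega> \<partial>M) = 0"
    and bound: "\<And>s. s \<in> {a..b} \<Longrightarrow> (\<integral>\<omega>. \<bar>Y s \<omega>\<bar> \<partial>M) \<le> C"
  shows "integrable M (\<lambda>\<omega>. integral {a..b} (\<lambda>s. Y s \<omega>))"
    and "(\<integral>\<omega>. integral {a..b} (\<lambda>s. Y s \<omega>) \<partial>M) = 0"
proof -
  interpret pair_sigma_finite lborel M
    using assms by (simp add: pair_sigma_finite_def lborel.sigma_finite_measure_axioms)
  let ?Y = "\<lambda>s \<omega>. indicator {a..b} s * Y (max a (min b s)) \<omega>"
  have clamp: "max a (min b s) \<in> {a..b}" for s using ab by auto
  have jm[measurable]: "case_prod ?Y \<in> borel_measurable (lborel \<Otimes>\<^sub>M M)"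
    by (rule clamped_process_jointly_measurable)
  have "integrable lborel (\<lambda>s. \<integral>\<omega>. norm (case_prod ?Y (s, \<omega>)) \<partial>M)"
  proof (rule Bochner_Integration.integrable_bound)
    show "integrable lborel (\<lambda>s. indicator {a..b} s * C)" by (auto simp: ab)
    show "(\<lambda>s. \<integral>\<omega>. norm (case_prod ?Y (s, \<omega>)) \<partial>M) \<in> borel_measurable lborel"
      by measurable
    show "AE s in lborel. norm (\<integral>\<omega>. norm (case_prod ?Y (s, \<omega>)) \<partial>M) \<le> norm (indicator {a..b} s * C)"
      by (intro AE_I2) (auto simp: indicator_def intro: order_trans[OF bound])
  qed
  then have I: "integrable (lborel \<Otimes>\<^sub>M M) (case_prod ?Y)"
    by (intro Fubini_integrable jm AE_I2) (auto intro!: integrable_mult_right int clamp)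
  have "integrable M (\<lambda>\<omega>. \<integral>s. ?Y s \<omega> \<partial>lborel)" using integrable_snd[OF I] .
  then show "integrable M (\<lambda>\<omega>. integral {a..b} (\<lambda>s. Y s \<omega>))"
    by (subst Bochner_Integration.integrable_cong[OF refl time_integral_eq_lebesgue])
  have "(\<integral>\<omega>. integral {a..b} (\<lambda>s. Y s \<omega>) \<partial>M) = (\<integral>\<omega>. (\<integral>s. ?Y s \<omega> \<partial>lborel) \<partial>M)"
    by (rule Bochner_Integration.integral_cong[OF refl time_integral_eq_lebesgue])
  also have "\<dots> = (\<integral>s. (\<integral>\<omega>. ?Y s \<omega> \<partial>M) \<partial>lborel)" by (rule Fubini_integral[OF I])
  also have "\<dots> = 0" by (simp add: mean[OF clamp])
  finally show "(\<integral>\<omega>. integral {a..b} (\<lambda>s. Y s \<omega>) \<partial>M) = 0" .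
qed

end

section \<open>Expected dividends\<close>

lemma brownian_increment_moments:
  assumes W: "brownian_motion M W" and "0 \<le> t" "t \<le> s"
  shows "integrable M (\<lambda>\<omega>. W s \<omega> - W t \<omega>)"
    and "(\<integral>\<omega>. W s \<omega> - W t \<omega> \<partial>M) = 0"
    and "(\<integral>\<omega>. \<bar>W s \<omega> - W t \<omega>\<bar> \<partial>M) \<le> sqrt (s - t)"
proof -
  interpret prob_space M using W by (simp add: brownian_motion_def)
  have *: "integrable M (\<lambda>\<omega>. W s \<omega> - W t \<omega>) \<and> (\<integral>\<omega>. W s \<omega> - W t \<omega> \<partial>M) = 0 \<and>
    (\<integral>\<omega>. \<bar>W s \<omega> - W t \<omega>\<bar> \<partial>M) \<le> sqrt (s - t)"
  proof (cases "s = t")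
    case False
    then have pos: "0 < sqrt (s - t)" using assms by simp
    have D: "distributed M lborel (\<lambda>\<omega>. W s \<omega> - W t \<omega>) (normal_density 0 (sqrt (s - t)))"
      using W assms False by (simp add: brownian_motion_def)
    have "integrable M (\<lambda>\<omega>. W s \<omega> - W t \<omega>)"
      using distributed_integrable[OF D, of "\<lambda>x. x"] integrable_normal_moment_nz_1[OF pos, of 0]
      by auto
    moreover have "(\<integral>\<omega>. W s \<omega> - W t \<omega> \<partial>M) = 0"
      by (rule normal_distributed_expectation[OF pos D])
    moreover have "(\<integral>\<omega>. \<bar>W s \<omega> - W t \<omega>\<bar> \<partial>M) = sqrt (s - t) * sqrt (2 / pi)"
      using distributed_integral[OF D, of abs] integral_normal_moment_abs_odd[OF pos, of 0 0]
      by auto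
    moreover have "sqrt (s - t) * sqrt (2 / pi) \<le> sqrt (s - t)"
      using pi_ge_two pos by (intro mult_left_le) auto
    ultimately show ?thesis by simp
  qed simp
  then show "integrable M (\<lambda>\<omega>. W s \<omega> - W t \<omega>)" "(\<integral>\<omega>. W s \<omega> - W t \<omega> \<partial>M) = 0"
    "(\<integral>\<omega>. \<bar>W s \<omega> - W t \<omega>\<bar> \<partial>M) \<le> sqrt (s - t)" by blast+
qed

text \<open>
  Additive noise allows an integration by parts along each path: \<open>N\<close> is the surplus \<open>Y\<close> with its
  martingale part removed, hence differentiable in time, and the ordinary fundamental theorem of
  calculus applies to \<open>exp (- \<delta>' (s - t)) (A s + B s N s)\<close>. The equations for \<open>A\<close> and \<open>B\<close> make the
  derivative equal to minus the discounted dividend rate, up to a multiple of \<open>Y - N\<close>, and the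
  terminal values make the boundary term equal to \<open>- (A t + B t x)\<close>.
\<close>

lemma pathwise_dividend_identity:
  fixes A B a b f Y :: "real \<Rightarrow> real" and \<delta>' x t T :: real
  defines "N \<equiv> \<lambda>s. x + integral {t..s} (\<lambda>u. a u - b u * Y u)"
  assumes tT: "t \<le> T"
    and cont: "continuous_on {t..T} a" "continuous_on {t..T} b" "continuous_on {t..T} f" "continuous_on {t..T} Y"
    and B: "\<And>s. s \<in> {t..T} \<Longrightarrow>
      (B has_real_derivative \<delta>' * B s - b s + b s * B s) (at s within {t..T})"
    and A: "\<And>s. s \<in> {t..T} \<Longrightarrow>
      (A has_real_derivative \<delta>' * A s - f s - a s * B s) (at s within {t..T})"
    and terminal: "A T = 0" "B T = 0"
  shows "integral {t..T} (\<lambda>s. exp (- \<delta>' * (s - t)) * (f s + b s * Y s)) =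
    A t + B t * x + integral {t..T} (\<lambda>s. exp (- \<delta>' * (s - t)) * b s * (1 - B s) * (Y s - N s))"
proof -
  let ?e = "\<lambda>s. exp (- \<delta>' * (s - t))"
  have N: "(N has_real_derivative a s - b s * Y s) (at s within {t..T})" if "s \<in> {t..T}" for s
  proof -
    have "((\<lambda>s. integral {t..s} (\<lambda>u. a u - b u * Y u)) has_real_derivative a s - b s * Y s)
        (at s within {t..T})"
      by (rule integral_has_real_derivative[OF _ that]) (intro continuous_intros cont)
    from DERIV_add[OF DERIV_const[of x] this] show ?thesis by (simp add: N_def)
  qed
  have contBN: "continuous_on {t..T} B" "continuous_on {t..T} N"
    using B N by (meson DERIV_continuous continuous_on_eq_continuous_within)+
  define g where "g s = - (?e s * (f s + b s * Y s)) + ?e s * b s * (1 - B s) * (Y s - N s)" for s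
  have "((\<lambda>s. ?e s * (A s + B s * N s)) has_real_derivative g s) (at s within {t..T})"
    if s: "s \<in> {t..T}" for s
    unfolding g_def
    by (auto intro!: derivative_eq_intros A[OF s] B[OF s] N[OF s] simp: algebra_simps)
  then have "(g has_integral ?e T * (A T + B T * N T) - ?e t * (A t + B t * N t)) {t..T}"
    by (intro fundamental_theorem_of_calculus tT)
      (auto simp: has_real_derivative_iff_has_vector_derivative)
  then have "integral {t..T} g = - (A t + B t * x)"
    by (simp add: terminal N_def integral_unique)
  moreover have "integral {t..T} g = - integral {t..T} (\<lambda>s. ?e s * (f s + b s * Y s))
      + integral {t..T} (\<lambda>s. ?e s * b s * (1 - B s) * (Y s - N s))"
    unfolding g_def
    by (subst Henstock_Kurzweil_Integration.integral_add)
      (auto intro!: integrable_continuous_real continuous_intros cont contBN)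
  ultimately show ?thesis by simp
qed

text \<open>
  In the pathwise identity, \<open>Y - N\<close> is almost surely \<open>\<sigma> (W s - W t)\<close>, which is centred with a first
  absolute moment bounded on \<open>[t, T]\<close>. The time integral of its multiple by a continuous function
  therefore has mean zero, and only the affine part is left.
\<close>

lemma expected_dividends_affine:
  fixes A B q p :: "real \<Rightarrow> real"
  assumes W: "brownian_motion M W" and t: "0 \<le> t" "t \<le> T"
    and cont: "continuous_on {t..T} q" "continuous_on {t..T} p"
    and sol: "surplus_solution M W T c \<sigma> l0 l1 q p t x (X t x)"
    and B: "\<And>s. s \<in> {t..T} \<Longrightarrow> (B has_real_derivative
      \<delta>' * B s - (l1 + 2 * q s) + (l1 + 2 * q s) * B s) (at s within {t..T})"
    and A: "\<And>s. s \<in> {t..T} \<Longrightarrow> (A has_real_derivative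
      \<delta>' * A s - (l0 + p s) - (c - l0 - p s) * B s) (at s within {t..T})"
    and terminal: "A T = 0" "B T = 0"
  shows "VLQ M X T \<delta>' l0 l1 q p t x = A t + B t * x"
proof -
  interpret prob_space M using W by (simp add: brownian_motion_def)
  define Y where "Y = X t x"
  define a where "a s = c - l0 - p s" for s
  define b where "b s = l1 + 2 * q s" for s
  define N where "N s \<omega> = x + integral {t..s} (\<lambda>u. a u - b u * Y u \<omega>)" for s \<omega>
  define h where "h s = exp (- \<delta>' * (s - t)) * b s * (1 - B s)" for s
  define Z where "Z s \<omega> = h s * (Y s \<omega> - N s \<omega>)" for s \<omega>
  have Ym: "Y s \<in> borel_measurable M" if "s \<in> {t..T}" for s
    using sol that by (auto simp: surplus_solution_def Y_def)
  have Yc: "continuous_on {t..T} (\<lambda>s. Y s \<omega>)" if "\<omega> \<in> space M" for \<omega>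
    using sol that by (auto simp: surplus_solution_def Y_def)
  have ac: "continuous_on {t..T} a" and bc: "continuous_on {t..T} b"
    unfolding a_def b_def by (intro continuous_intros cont)+
  have Bc: "continuous_on {t..T} B"
    using B by (meson DERIV_continuous continuous_on_eq_continuous_within)
  have hc: "continuous_on {t..T} h"
    unfolding h_def by (intro continuous_intros bc Bc)
  have dc: "continuous_on {t..T} (\<lambda>u. a u - b u * Y u \<omega>)" if "\<omega> \<in> space M" for \<omega>
    by (intro continuous_intros ac bc Yc that)
  have Nm: "N s \<in> borel_measurable M" if s: "s \<in> {t..T}" for s
  proof -
    have "(\<lambda>\<omega>. integral {t..s} (\<lambda>u. a u - b u * Y u \<omega>)) \<in> borel_measurable M"
    proof (rule time_integral_measurable)
      show "t \<le> s" using s by simp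
      show "(\<lambda>\<omega>. a u - b u * Y u \<omega>) \<in> borel_measurable M" if "u \<in> {t..s}" for u
      proof -
        have [measurable]: "Y u \<in> borel_measurable M" using Ym[of u] that s by simp
        show ?thesis by measurable
      qed
      show "continuous_on {t..s} (\<lambda>u. a u - b u * Y u \<omega>)" if "\<omega> \<in> space M" for \<omega>
        using dc[OF that] by (rule continuous_on_subset) (use s in auto)
    qed unfold_locales
    then show ?thesis unfolding N_def by measurable
  qed
  have Nc: "continuous_on {t..T} (\<lambda>s. N s \<omega>)" if "\<omega> \<in> space M" for \<omega>
    unfolding N_def
    by (intro continuous_intros indefinite_integral_continuous_1 integrable_continuous_real dc that)
  have Zm: "Z s \<in> borel_measurable M" if "s \<in> {t..T}" for s
    unfolding Z_def using Ym[OF that] Nm[OF that] by measurable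
  have Zc: "continuous_on {t..T} (\<lambda>s. Z s \<omega>)" if "\<omega> \<in> space M" for \<omega>
    unfolding Z_def by (intro continuous_intros hc Yc Nc that)
  have Wm: "W s \<in> borel_measurable M" if "0 \<le> s" for s
    using W that by (auto simp: brownian_motion_def)
  have Z_eq: "AE \<omega> in M. Z s \<omega> = h s * \<sigma> * (W s \<omega> - W t \<omega>)" if s: "s \<in> {t..T}" for s
  proof -
    have "AE \<omega> in M. \<forall>s\<in>{t..T}. Y s \<omega> = N s \<omega> + \<sigma> * (W s \<omega> - W t \<omega>)"
      using sol by (simp add: surplus_solution_def Y_def N_def a_def b_def)
    then show ?thesis by eventually_elim (use s in \<open>simp add: Z_def\<close>)
  qed
  note inc = brownian_increment_moments[OF W t(1)]
  obtain H where H: "\<And>s. s \<in> {t..T} \<Longrightarrow> \<bar>h s\<bar> \<le> H"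
    using continuous_on_compact_bound[OF compact_Icc hc] by (auto simp: norm_real)
  have Z_int: "integrable M (Z s)" and Z_mean: "expectation (Z s) = 0"
    and Z_abs: "expectation (\<lambda>\<omega>. \<bar>Z s \<omega>\<bar>) \<le> H * \<bar>\<sigma>\<bar> * sqrt (T - t)" if s: "s \<in> {t..T}" for s
  proof -
    have ts: "t \<le> s" and s0: "0 \<le> s" using s t by auto
    note [measurable] = Zm[OF s] Wm[OF s0] Wm[OF t(1)]
    show "integrable M (Z s)"
      by (subst integrable_cong_AE[OF _ _ Z_eq[OF s]]) (auto intro!: inc(1)[OF ts] integrable_mult_right)
    have "expectation (Z s) = expectation (\<lambda>\<omega>. h s * \<sigma> * (W s \<omega> - W t \<omega>))"
      by (rule integral_cong_AE[OF _ _ Z_eq[OF s]]) measurable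
    also have "\<dots> = h s * \<sigma> * expectation (\<lambda>\<omega>. W s \<omega> - W t \<omega>)"
      by (rule integral_mult_right_zero)
    finally show "expectation (Z s) = 0" by (simp only: inc(2)[OF ts] mult_zero_right)
    have "expectation (\<lambda>\<omega>. \<bar>Z s \<omega>\<bar>) = expectation (\<lambda>\<omega>. \<bar>h s * \<sigma>\<bar> * \<bar>W s \<omega> - W t \<omega>\<bar>)"
      by (rule integral_cong_AE) (use Z_eq[OF s] in \<open>auto simp: abs_mult\<close>)
    also have "\<dots> = \<bar>h s * \<sigma>\<bar> * expectation (\<lambda>\<omega>. \<bar>W s \<omega> - W t \<omega>\<bar>)"
      by (rule integral_mult_right_zero)
    also have "\<dots> \<le> \<bar>h s * \<sigma>\<bar> * sqrt (s - t)"
      by (intro mult_left_mono inc(3)[OF ts]) simp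
    also have "\<dots> \<le> H * \<bar>\<sigma>\<bar> * sqrt (T - t)"
      unfolding abs_mult by (intro mult_mono H[OF s] order_refl) (use s H[OF s] in auto)
    finally show "expectation (\<lambda>\<omega>. \<bar>Z s \<omega>\<bar>) \<le> H * \<bar>\<sigma>\<bar> * sqrt (T - t)" .
  qed
  have sf: "sigma_finite_measure M" by unfold_locales
  note Z = time_integral_mean_zero[where M = M and Y = Z, OF t(2) Zm Zc sf Z_int Z_mean Z_abs]
  have path: "integral {t..T} (\<lambda>s. exp (- \<delta>' * (s - t)) * (l0 + p s + (l1 + 2 * q s) * X t x s \<omega>))
      = A t + B t * x + integral {t..T} (\<lambda>s. Z s \<omega>)" if "\<omega> \<in> space M" for \<omega>
    using pathwise_dividend_identity[where A = A and B = B and a = a and b = b and x = x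
        and f = "\<lambda>s. l0 + p s" and Y = "\<lambda>s. Y s \<omega>" and \<delta>' = \<delta>', OF t(2) ac bc _ Yc[OF that] _ _ terminal]
      A B cont by (simp add: Z_def N_def h_def Y_def a_def b_def continuous_intros)
  have "VLQ M X T \<delta>' l0 l1 q p t x = expectation (\<lambda>\<omega>. A t + B t * x + integral {t..T} (\<lambda>s. Z s \<omega>))"
    unfolding VLQ_def by (rule Bochner_Integration.integral_cong[OF refl path])
  also have "\<dots> = A t + B t * x"
    using Z by (simp add: prob_space)
  finally show ?thesis .
qed

section \<open>Uniqueness for the parabolic equation\<close>

lemma local_max_second_derivative:
  fixes f f' :: "real \<Rightarrow> real"
  assumes d: "0 < d" and f: "\<And>y. \<bar>y - x\<bar> < d \<Longrightarrow> (f has_real_derivative f' y) (at y)"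
    and f': "(f' has_real_derivative D) (at x)"
    and max: "\<And>y. \<bar>y - x\<bar> < d \<Longrightarrow> f y \<le> f x"
  shows "f' x = 0" "D \<le> 0"
proof -
  show 0: "f' x = 0"
    using DERIV_local_max[OF f[of x] d] max d by (simp add: abs_minus_commute)
  show "D \<le> 0"
  proof (rule ccontr)
    assume "\<not> D \<le> 0"
    then obtain e where e: "e > 0" "\<And>h. 0 < h \<Longrightarrow> h < e \<Longrightarrow> f' x < f' (x + h)"
      using DERIV_pos_inc_right[OF f'] by auto
    define k where "k = min d e / 2"
    have k: "0 < k" "k < d" "k < e" using d e by (auto simp: k_def)
    obtain z where z: "x < z" "z < x + k" "f (x + k) - f x = (x + k - x) * f' z"
      using MVT2[of x "x + k" f f'] f k by force
    have "0 < f' z" using e(2)[of "z - x"] z k 0 by simp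
    then have "f x < f (x + k)" using z(3) k by (simp add: algebra_simps zero_less_mult_iff)
    then show False using max[of "x + k"] k by simp
  qed
qed

text \<open>
  A positive value would give a positive maximum over the rectangle, attained neither at the terminal
  time nor on the lateral boundary. At such a point the first space derivative vanishes and the second is
  nonpositive, so \<open>strict\<close> makes the function increase in time, against maximality. The equation
  runs backwards, so the maximum may lie at the initial time \<open>t1\<close>; the one-sided time derivative
  suffices there.
\<close>

lemma parabolic_maximum_principle:
  fixes y yt yx yxx :: "real \<Rightarrow> real \<Rightarrow> real"
  assumes t: "t1 < t2" and R: "0 < R"
    and cont: "continuous_on ({t1..t2} \<times> {-R..R}) (\<lambda>(t, x). y t x)"
    and yt: "\<And>t x. \<lbrakk>t \<in> {t1..<t2}; \<bar>x\<bar> < R\<rbrakk> \<Longrightarrow>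
      ((\<lambda>s. y s x) has_real_derivative yt t x) (at t within {t1..t2})"
    and yx: "\<And>t x. \<lbrakk>t \<in> {t1..<t2}; \<bar>x\<bar> < R\<rbrakk> \<Longrightarrow> (y t has_real_derivative yx t x) (at x)"
    and yxx: "\<And>t x. \<lbrakk>t \<in> {t1..<t2}; \<bar>x\<bar> < R\<rbrakk> \<Longrightarrow> (yx t has_real_derivative yxx t x) (at x)"
    and strict: "\<And>t x. \<lbrakk>t \<in> {t1..<t2}; \<bar>x\<bar> < R; yx t x = 0; yxx t x \<le> 0\<rbrakk> \<Longrightarrow> 0 < yt t x"
    and terminal: "\<And>x. \<bar>x\<bar> \<le> R \<Longrightarrow> y t2 x \<le> 0"
    and lateral: "\<And>t x. t \<in> {t1..t2} \<Longrightarrow> \<bar>x\<bar> = R \<Longrightarrow> y t x \<le> 0"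
    and "t \<in> {t1..t2}" "\<bar>x\<bar> \<le> R"
  shows "y t x \<le> 0"
proof (rule ccontr)
  assume pos: "\<not> y t x \<le> 0"
  let ?K = "{t1..t2} \<times> {-R..R}"
  have "(t, x) \<in> ?K" using assms by auto
  moreover have "compact ?K" by (intro compact_Times compact_Icc)
  ultimately obtain m where m: "m \<in> ?K" "\<And>z. z \<in> ?K \<Longrightarrow> (case z of (t, x) \<Rightarrow> y t x) \<le> (case m of (t, x) \<Rightarrow> y t x)"
    using continuous_attains_sup[OF _ _ cont] by blast
  obtain s \<xi> where m_eq: "m = (s, \<xi>)" by (cases m)
  have max: "y r z \<le> y s \<xi>" if "r \<in> {t1..t2}" "\<bar>z\<bar> \<le> R" for r z
    using m(2)[of "(r, z)"] that by (simp add: m_eq abs_le_iff minus_le_iff)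
  have "0 < y s \<xi>" using max[of t x] assms pos by auto
  moreover have m': "s \<in> {t1..t2}" "\<bar>\<xi>\<bar> \<le> R" using m(1) by (auto simp: m_eq)
  ultimately have "s \<noteq> t2" "\<bar>\<xi>\<bar> \<noteq> R" using terminal[of \<xi>] lateral[of s \<xi>] by auto
  then have s: "s \<in> {t1..<t2}" and \<xi>: "\<bar>\<xi>\<bar> < R" using m' by auto
  define d where "d = R - \<bar>\<xi>\<bar>"
  have d: "0 < d" using \<xi> by (simp add: d_def)
  have near: "\<bar>z\<bar> < R" if "\<bar>z - \<xi>\<bar> < d" for z using that by (simp add: d_def)
  have "yx s \<xi> = 0" "yxx s \<xi> \<le> 0"
    using local_max_second_derivative[OF d yx[OF s near] yxx[OF s \<xi>]] max near s
    by (simp_all add: less_imp_le)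
  then have "0 < yt s \<xi>" by (rule strict[OF s \<xi>])
  then obtain e where e: "e > 0" "\<And>h. \<lbrakk>0 < h; s + h \<in> {t1..t2}; h < e\<rbrakk> \<Longrightarrow> y s \<xi> < y (s + h) \<xi>"
    using has_real_derivative_pos_inc_right[OF yt[OF s \<xi>]] by blast
  define h where "h = min (t2 - s) (e / 2)"
  have "0 < h" "s + h \<in> {t1..t2}" "h < e" using e s by (auto simp: h_def)
  then show False using e(2)[of h] max[of "s + h" \<xi>] \<xi> by auto
qed

text \<open>
  On large rectangles \<open>z\<close> is compared with small multiples of the barrier
  \<open>\<psi> t x = exp (k t * x\<^sup>2 + \<nu> * (t2 - t))\<close>, and the multiple then tends to zero. Since \<open>k\<close> stays at or
  above \<open>2 \<alpha>\<close>, the barrier beats the growth bound of \<open>z\<close> at large \<open>x\<close>. It is a strict supersolution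
  because \<open>k\<close> increases towards the past so fast that the \<open>x\<^sup>2\<close> terms produced by the linear drift and
  by \<open>\<psi>\<^sub>x\<^sub>x\<close> are dominated. The latter term is quadratic in \<open>k\<close>, so the slope that \<open>k\<close> needs grows faster
  than \<open>k\<close> itself; a linear \<open>k\<close> has it only while \<open>k \<le> 4 \<alpha>\<close>, hence the bound on \<open>t2 - t1\<close>.
\<close>

lemma barrier_upper_bound:
  fixes z zt zx zxx :: "real \<Rightarrow> real \<Rightarrow> real" and a b :: "real \<Rightarrow> real"
  assumes t: "t1 < t2" and \<alpha>: "0 < \<alpha>" and C: "0 < C" 
    and ab: "\<And>t. t \<in> {t1..<t2} \<Longrightarrow> \<bar>a t\<bar> \<le> K \<and> \<bar>b t\<bar> \<le> K"
    and h: "(t2 - t1) * (12 * K + 16 * \<sigma>\<^sup>2 * \<alpha> + 1) \<le> 1"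
    and cont: "continuous_on ({t1..t2} \<times> UNIV) (\<lambda>(t, x). z t x)"
    and zt: "\<And>t x. t \<in> {t1..<t2} \<Longrightarrow>
      ((\<lambda>s. z s x) has_real_derivative zt t x) (at t within {t1..t2})"
    and zx: "\<And>t x. t \<in> {t1..<t2} \<Longrightarrow> (z t has_real_derivative zx t x) (at x)"
    and zxx: "\<And>t x. t \<in> {t1..<t2} \<Longrightarrow> (zx t has_real_derivative zxx t x) (at x)"
    and pde: "\<And>t x. t \<in> {t1..<t2} \<Longrightarrow>
      zt t x + zx t x * (a t - b t * x) + 1 / 2 * zxx t x * \<sigma>\<^sup>2 = 0"
    and terminal: "\<And>x. z t2 x \<le> 0"
    and growth: "\<And>t x. t \<in> {t1..t2} \<Longrightarrow> z t x \<le> C * exp (\<alpha> * x\<^sup>2)"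
    and t': "t \<in> {t1..t2}"
  shows "z t x \<le> 0"
proof (rule field_le_epsilon)
  fix e :: real assume e: "0 < e"
  have K: "0 \<le> K" using ab[of t1] t by force
  \<comment> \<open>With \<open>k \<le> 4 \<alpha>\<close>, the drift contributes at most \<open>12 \<alpha> K x\<^sup>2 + 4 \<alpha> K\<close> and the diffusion at most
    \<open>32 \<alpha>\<^sup>2 \<sigma>\<^sup>2 x\<^sup>2 + 4 \<alpha> \<sigma>\<^sup>2\<close>; \<open>L\<close> absorbs the quadratic and \<open>\<nu>\<close> the constant parts.\<close>
  define L where "L = 12 * K + 16 * \<sigma>\<^sup>2 * \<alpha> + 1"
  define \<nu> where "\<nu> = 4 * \<alpha> * K + 4 * \<sigma>\<^sup>2 * \<alpha> + 1"
  define k where "k t = 2 * \<alpha> * (1 + L * (t2 - t))" for t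
  have L: "0 < L" using K \<alpha> by (auto simp: L_def intro!: add_nonneg_pos)
  have \<nu>: "0 < \<nu>" using K \<alpha> by (auto simp: \<nu>_def intro!: add_nonneg_pos)
  have k: "2 * \<alpha> \<le> k s" "k s \<le> 4 * \<alpha>" if "s \<in> {t1..t2}" for s
  proof -
    have "0 \<le> L * (t2 - s)" using L that by simp
    moreover have "L * (t2 - s) \<le> L * (t2 - t1)" using L that by (intro mult_left_mono) auto
    moreover have "L * (t2 - t1) \<le> 1" using h by (simp add: L_def mult.commute)
    ultimately have "0 \<le> L * (t2 - s)" "L * (t2 - s) \<le> 1" by linarith+
    then have "\<alpha> * 0 \<le> \<alpha> * (L * (t2 - s))" "\<alpha> * (L * (t2 - s)) \<le> \<alpha> * 1"
      using \<alpha> by (auto intro!: mult_left_mono)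
    then show "2 * \<alpha> \<le> k s" "k s \<le> 4 * \<alpha>" unfolding k_def by (simp_all add: algebra_simps)
  qed
  define \<psi> where "\<psi> t x = exp (k t * x\<^sup>2 + \<nu> * (t2 - t))" for t x
  \<comment> \<open>Normalised so that the bound \<open>\<epsilon> \<psi>\<close> at the given point is exactly \<open>e\<close>.\<close>
  define \<epsilon> where "\<epsilon> = e / \<psi> t x"
  have \<epsilon>: "0 < \<epsilon>" using e by (simp add: \<epsilon>_def \<psi>_def)
  have \<psi>t: "((\<lambda>s. \<psi> s x) has_real_derivative \<psi> s x * (- 2 * \<alpha> * L * x\<^sup>2 - \<nu>)) (at s within S)" for s x S
    unfolding \<psi>_def k_def by (auto intro!: derivative_eq_intros simp: algebra_simps)
  have \<psi>x: "(\<psi> s has_real_derivative \<psi> s x * (2 * k s * x)) (at x)" for s x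
    unfolding \<psi>_def[abs_def] by (auto intro!: derivative_eq_intros)
  have \<psi>xx: "((\<lambda>x. \<psi> s x * (2 * k s * x)) has_real_derivative
      \<psi> s x * (2 * k s + 4 * (k s)\<^sup>2 * x\<^sup>2)) (at x)" for s x
    by (auto intro!: derivative_eq_intros \<psi>x simp: power2_eq_square algebra_simps)
  have super: "- 2 * \<alpha> * L * x\<^sup>2 - \<nu> + 2 * k s * x * (a s - b s * x)
      + 1 / 2 * (2 * k s + 4 * (k s)\<^sup>2 * x\<^sup>2) * \<sigma>\<^sup>2 < 0" if s: "s \<in> {t1..<t2}" for s x
  proof -
    have ks: "0 \<le> k s" "k s \<le> 4 * \<alpha>" using k[of s] s \<alpha> by auto
    have "2 * x * a s \<le> K * (1 + x\<^sup>2)"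
    proof -
      have "2 * x * a s \<le> \<bar>2 * x\<bar> * \<bar>a s\<bar>" by (metis abs_ge_self abs_mult)
      also have "\<dots> \<le> (1 + x\<^sup>2) * K"
        using ab[OF s] K sum_squares_bound[of 1 "\<bar>x\<bar>"] by (intro mult_mono) auto
      finally show ?thesis by (simp add: mult.commute)
    qed
    moreover have "- (2 * b s * x\<^sup>2) \<le> 2 * K * x\<^sup>2"
      using mult_right_mono[of "- b s" K "x\<^sup>2"] ab[OF s] by auto
    ultimately have "2 * x * a s - 2 * b s * x\<^sup>2 \<le> K + 3 * K * x\<^sup>2"
      unfolding distrib_left by linarith
    then have "k s * (2 * x * a s - 2 * b s * x\<^sup>2) \<le> k s * (K + 3 * K * x\<^sup>2)"
      using ks by (intro mult_left_mono) auto
    also have "\<dots> \<le> 4 * \<alpha> * (K + 3 * K * x\<^sup>2)"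
      using ks K by (intro mult_right_mono) auto
    finally have drift: "2 * k s * x * (a s - b s * x) \<le> 4 * \<alpha> * (K + 3 * K * x\<^sup>2)"
      by (simp add: power2_eq_square algebra_simps)
    have "k s + 2 * (k s)\<^sup>2 * x\<^sup>2 \<le> 4 * \<alpha> + 2 * (4 * \<alpha>)\<^sup>2 * x\<^sup>2"
      using ks by (intro add_mono mult_right_mono mult_left_mono power_mono) auto
    then have diff: "1 / 2 * (2 * k s + 4 * (k s)\<^sup>2 * x\<^sup>2) * \<sigma>\<^sup>2 \<le> (4 * \<alpha> + 2 * (4 * \<alpha>)\<^sup>2 * x\<^sup>2) * \<sigma>\<^sup>2"
      by (intro mult_right_mono) auto
    have "- 2 * \<alpha> * L * x\<^sup>2 - \<nu> + 4 * \<alpha> * (K + 3 * K * x\<^sup>2) + (4 * \<alpha> + 2 * (4 * \<alpha>)\<^sup>2 * x\<^sup>2) * \<sigma>\<^sup>2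
        = - 12 * \<alpha> * K * x\<^sup>2 - 2 * \<alpha> * x\<^sup>2 - 1"
      unfolding L_def \<nu>_def by (simp add: power2_eq_square algebra_simps)
    also have "\<dots> < 0"
    proof -
      have "0 \<le> \<alpha> * K * x\<^sup>2" "0 \<le> \<alpha> * x\<^sup>2" using \<alpha> K by auto
      then show ?thesis by linarith
    qed
    finally show ?thesis using drift diff by linarith
  qed
  obtain R where R: "0 < R" "\<bar>x\<bar> \<le> R" "C \<le> \<epsilon> * exp (\<alpha> * R\<^sup>2)"
  proof -
    \<comment> \<open>\<open>1 \<le> R\<close> gives \<open>R \<le> R\<^sup>2\<close>, so the last summand already makes \<open>\<epsilon> \<alpha> R\<^sup>2 \<ge> C\<close>.\<close>
    define R where "R = \<bar>x\<bar> + 1 + C / (\<epsilon> * \<alpha>)"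
    have pos: "0 < C / (\<epsilon> * \<alpha>)" using C \<epsilon> \<alpha> by simp
    have "1 \<le> R" using pos by (simp add: R_def)
    then have "R \<le> R\<^sup>2" by (simp add: power2_eq_square)
    then have "C / (\<epsilon> * \<alpha>) \<le> R\<^sup>2" using R_def by linarith
    then have "C \<le> \<epsilon> * (\<alpha> * R\<^sup>2)" using \<epsilon> \<alpha> by (simp add: field_simps)
    also have "\<dots> \<le> \<epsilon> * exp (\<alpha> * R\<^sup>2)"
      using \<epsilon> exp_ge_add_one_self[of "\<alpha> * R\<^sup>2"] by (intro mult_left_mono) linarith+
    finally show thesis using pos by (intro that[of R]) (auto simp: R_def)
  qed
  have "z t x - \<epsilon> * \<psi> t x \<le> 0"
  proof (rule parabolic_maximum_principle[OF t R(1), where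
        y = "\<lambda>t x. z t x - \<epsilon> * \<psi> t x"
        and yt = "\<lambda>t x. zt t x - \<epsilon> * (\<psi> t x * (- 2 * \<alpha> * L * x\<^sup>2 - \<nu>))"
        and yx = "\<lambda>t x. zx t x - \<epsilon> * (\<psi> t x * (2 * k t * x))"
        and yxx = "\<lambda>t x. zxx t x - \<epsilon> * (\<psi> t x * (2 * k t + 4 * (k t)\<^sup>2 * x\<^sup>2))"])
    show "continuous_on ({t1..t2} \<times> {-R..R}) (\<lambda>(t, x). z t x - \<epsilon> * \<psi> t x)"
    proof -
      have "continuous_on ({t1..t2} \<times> {-R..R}) (\<lambda>u. z (fst u) (snd u))"
        using continuous_on_subset[OF cont, of "{t1..t2} \<times> {-R..R}"] by (auto simp: case_prod_beta')
      then show ?thesis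
        unfolding case_prod_beta' \<psi>_def k_def by (intro continuous_intros)
    qed
    show "z t2 x - \<epsilon> * \<psi> t2 x \<le> 0" for x
      using terminal[of x] \<epsilon> by (simp add: \<psi>_def add_nonpos_nonpos order_trans)
    show "z s x - \<epsilon> * \<psi> s x \<le> 0" if s: "s \<in> {t1..t2}" and x: "\<bar>x\<bar> = R" for s x
    proof -
      have x2: "x\<^sup>2 = R\<^sup>2" using x power2_abs by metis
      have "z s x \<le> C * exp (\<alpha> * R\<^sup>2)" using growth[OF s, of x] by (simp add: x2)
      also have "\<dots> \<le> (\<epsilon> * exp (\<alpha> * R\<^sup>2)) * exp (\<alpha> * R\<^sup>2)" using R by (intro mult_right_mono) auto
      also have "\<dots> = \<epsilon> * exp (2 * \<alpha> * R\<^sup>2)" by (simp flip: exp_add)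
      also have "\<dots> \<le> \<epsilon> * \<psi> s x"
      proof -
        have "2 * \<alpha> * R\<^sup>2 \<le> k s * R\<^sup>2" using k[OF s] by (intro mult_right_mono) auto
        moreover have "0 \<le> \<nu> * (t2 - s)" using \<nu> s by auto
        ultimately show ?thesis unfolding \<psi>_def x2 using \<epsilon> by (intro mult_left_mono) auto
      qed
      finally show ?thesis by simp
    qed
    fix s x assume s: "s \<in> {t1..<t2}"
    show "((\<lambda>s. z s x - \<epsilon> * \<psi> s x) has_real_derivative
        zt s x - \<epsilon> * (\<psi> s x * (- 2 * \<alpha> * L * x\<^sup>2 - \<nu>))) (at s within {t1..t2})"
      by (rule DERIV_diff[OF zt[OF s] DERIV_cmult[OF \<psi>t]])
    show "((\<lambda>x. z s x - \<epsilon> * \<psi> s x) has_real_derivative zx s x - \<epsilon> * (\<psi> s x * (2 * k s * x))) (at x)"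
      by (rule DERIV_diff[OF zx[OF s] DERIV_cmult[OF \<psi>x]])
    show "((\<lambda>x. zx s x - \<epsilon> * (\<psi> s x * (2 * k s * x))) has_real_derivative
        zxx s x - \<epsilon> * (\<psi> s x * (2 * k s + 4 * (k s)\<^sup>2 * x\<^sup>2))) (at x)"
      by (rule DERIV_diff[OF zxx[OF s] DERIV_cmult[OF \<psi>xx]])
    assume y1: "zx s x - \<epsilon> * (\<psi> s x * (2 * k s * x)) = 0"
      and y2: "zxx s x - \<epsilon> * (\<psi> s x * (2 * k s + 4 * (k s)\<^sup>2 * x\<^sup>2)) \<le> 0"
    define P where "P = \<epsilon> * \<psi> s x"
    define S where "S = - 2 * \<alpha> * L * x\<^sup>2 - \<nu> + 2 * k s * x * (a s - b s * x)
      + 1 / 2 * (2 * k s + 4 * (k s)\<^sup>2 * x\<^sup>2) * \<sigma>\<^sup>2"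
    define Q where "Q = zxx s x - P * (2 * k s + 4 * (k s)\<^sup>2 * x\<^sup>2)"
    have "P * S < 0" using super[OF s, of x] \<epsilon> unfolding P_def S_def
      by (intro mult_pos_neg mult_pos_pos) (simp_all add: \<psi>_def)
    moreover have "Q * \<sigma>\<^sup>2 \<le> 0"
      using y2 by (intro mult_nonpos_nonneg) (auto simp: Q_def P_def mult.assoc)
    moreover have "zx s x = P * (2 * k s * x)" using y1 by (simp add: P_def)
    then have "zt s x = - (P * (2 * k s * x) * (a s - b s * x)) - 1 / 2 * zxx s x * \<sigma>\<^sup>2"
      using pde[OF s, of x] by simp
    then have "zt s x - P * (- 2 * \<alpha> * L * x\<^sup>2 - \<nu>) = - (P * S) - Q * \<sigma>\<^sup>2 / 2"
      unfolding S_def Q_def by (simp add: field_simps)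
    ultimately show "0 < zt s x - \<epsilon> * (\<psi> s x * (- 2 * \<alpha> * L * x\<^sup>2 - \<nu>))"
      unfolding P_def by (simp add: mult.assoc)
  qed (use t R t' in auto)
  also have "\<epsilon> * \<psi> t x = e" by (simp add: \<epsilon>_def \<psi>_def)
  finally show "z t x \<le> 0 + e" by simp
qed

text \<open>
  The barrier argument kills \<open>z\<close> on a time interval whose length \<open>1 / L\<close> depends on the coefficients and
  on the growth rate \<open>\<alpha>\<close> alone. The growth bound is uniform in time, so the argument restarts with the
  same step from the new zero terminal value and reaches time \<open>0\<close> after finitely many steps.
\<close>

lemma tychonoff_uniqueness:
  fixes z zt zx zxx :: "real \<Rightarrow> real \<Rightarrow> real" and a b :: "real \<Rightarrow> real"
  assumes \<alpha>: "0 < \<alpha>" and C: "0 < C"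
    and ab: "continuous_on {0..T} a" "continuous_on {0..T} b"
    and cont: "continuous_on ({0..T} \<times> UNIV) (\<lambda>(t, x). z t x)"
    and zt: "\<And>t x. t \<in> {0..<T} \<Longrightarrow>
      ((\<lambda>s. z s x) has_real_derivative zt t x) (at t within {0..T})"
    and zx: "\<And>t x. t \<in> {0..<T} \<Longrightarrow> (z t has_real_derivative zx t x) (at x)"
    and zxx: "\<And>t x. t \<in> {0..<T} \<Longrightarrow> (zx t has_real_derivative zxx t x) (at x)"
    and pde: "\<And>t x. t \<in> {0..<T} \<Longrightarrow>
      zt t x + zx t x * (a t - b t * x) + 1 / 2 * zxx t x * \<sigma>\<^sup>2 = 0"
    and terminal: "\<And>x. z T x = 0"
    and growth: "\<And>t x. t \<in> {0..T} \<Longrightarrow> \<bar>z t x\<bar> \<le> C * exp (\<alpha> * x\<^sup>2)"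
    and t: "t \<in> {0..T}"
  shows "z t x = 0"
proof -
  obtain Ka where Ka: "\<And>t. t \<in> {0..T} \<Longrightarrow> \<bar>a t\<bar> \<le> Ka"
    using continuous_on_compact_bound[OF compact_Icc ab(1)] by auto
  obtain Kb where Kb: "\<And>t. t \<in> {0..T} \<Longrightarrow> \<bar>b t\<bar> \<le> Kb"
    using continuous_on_compact_bound[OF compact_Icc ab(2)] by auto
  define K where "K = max Ka Kb"
  have K: "\<bar>a t\<bar> \<le> K \<and> \<bar>b t\<bar> \<le> K" if "t \<in> {0..T}" for t
    using Ka[OF that] Kb[OF that] by (auto simp: K_def)
  define L where "L = 12 * K + 16 * \<sigma>\<^sup>2 * \<alpha> + 1"
  have "0 \<le> K" using K[OF t] by linarith
  then have L: "0 < L" using \<alpha> by (auto simp: L_def intro!: add_nonneg_pos)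
  have step: "z s x = 0" if t12: "0 \<le> t1" "t1 < t2" "t2 \<le> T" and len: "(t2 - t1) * L \<le> 1"
    and end0: "\<And>x. z t2 x = 0" and s: "s \<in> {t1..t2}" for t1 t2 s x
  proof -
    have sub: "{t1..t2} \<subseteq> {0..T}" and sub': "r \<in> {t1..<t2} \<Longrightarrow> r \<in> {0..<T}" for r
      using t12 by auto
    have zt': "((\<lambda>s. z s x) has_real_derivative zt r x) (at r within {t1..t2})"
      if "r \<in> {t1..<t2}" for r x
      by (rule DERIV_subset[OF zt[OF sub'[OF that]] sub])
    have c: "continuous_on ({t1..t2} \<times> UNIV) (\<lambda>(t, x). z t x)"
      by (rule continuous_on_subset[OF cont]) (use sub in auto)
    have K': "\<bar>a r\<bar> \<le> K \<and> \<bar>b r\<bar> \<le> K" if "r \<in> {t1..<t2}" for r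
      using K[of r] that t12 by auto
    have g: "z r x \<le> C * exp (\<alpha> * x\<^sup>2)" "- z r x \<le> C * exp (\<alpha> * x\<^sup>2)" if "r \<in> {t1..t2}" for r x
      using growth[of r x] sub that by auto
    have "z s x \<le> 0"
      by (rule barrier_upper_bound[OF t12(2) \<alpha> C K' len[unfolded L_def] c zt' zx[OF sub'] zxx[OF sub']
            pde[OF sub'] _ g(1) s]) (simp_all add: end0)
    moreover have "- z s x \<le> 0"
    proof (rule barrier_upper_bound[OF t12(2) \<alpha> C K' len[unfolded L_def], where z = "\<lambda>t x. - z t x"
          and zt = "\<lambda>t x. - zt t x" and zx = "\<lambda>t x. - zx t x" and zxx = "\<lambda>t x. - zxx t x"])
      show "continuous_on ({t1..t2} \<times> UNIV) (\<lambda>(t, x). - z t x)"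
        using continuous_on_minus[OF c] by (simp add: case_prod_beta')
      show "- zt r x + - zx r x * (a r - b r * x) + 1 / 2 * - zxx r x * \<sigma>\<^sup>2 = 0"
        if "r \<in> {t1..<t2}" for r x
        using pde[OF sub'[OF that], of x] by (simp add: algebra_simps)
    qed (use s in \<open>simp_all add: end0 g DERIV_minus zt' zx[OF sub'] zxx[OF sub']\<close>)
    ultimately show ?thesis by simp
  qed
  have restarted: "\<forall>s x. s \<in> {max 0 (T - real n / L)..T} \<longrightarrow> z s x = 0" for n
  proof (induction n)
    case 0
    then show ?case using terminal by auto
  next
    case (Suc n)
    show ?case
    proof (intro allI impI)
      fix s x assume s: "s \<in> {max 0 (T - real (Suc n) / L)..T}"
      define t2 where "t2 = max 0 (T - real n / L)"
      show "z s x = 0"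
      proof (cases "t2 \<le> s")
        case True
        then show ?thesis using Suc.IH s by (simp add: t2_def)
      next
        case False
        have pos: "0 \<le> s" "s < t2" "t2 \<le> T" using False s t L by (auto simp: t2_def)
        have "T - real (Suc n) / L \<le> s" using s by simp
        moreover have "real (Suc n) / L = real n / L + 1 / L" by (simp add: add_divide_distrib)
        moreover have "t2 = T - real n / L" using False pos by (auto simp: t2_def)
        ultimately have "t2 - s \<le> 1 / L" by linarith
        then have "(t2 - s) * L \<le> 1" using L by (simp add: field_simps)
        moreover have "z t2 x = 0" for x using Suc.IH pos(3) by (simp add: t2_def)
        ultimately show ?thesis using step[OF pos] pos by simp
      qed
    qed
  qed
  obtain n where "T * L < real n" using reals_Archimedean2 by blast
  then have "T - real n / L \<le> 0" using L by (simp add: field_simps)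
  then show ?thesis using restarted[of n] t by simp
qed

text \<open>
  Without diffusion, a solution is constant along the characteristics \<open>\<phi>' = a - b \<phi>\<close>, which exist up to
  \<open>T\<close> because the drift is linear, and it vanishes at their end.
\<close>

lemma transport_uniqueness:
  fixes z zt zx :: "real \<Rightarrow> real \<Rightarrow> real" and a b :: "real \<Rightarrow> real"
  assumes ab: "continuous_on {0..T} a" "continuous_on {0..T} b"
    and cont: "continuous_on ({0..T} \<times> UNIV) (\<lambda>(t, x). z t x)"
    and zt: "\<And>t x. t \<in> {0..<T} \<Longrightarrow>
      ((\<lambda>s. z s x) has_real_derivative zt t x) (at t within {0..T})"
    and zx: "\<And>t x. t \<in> {0..<T} \<Longrightarrow> (z t has_real_derivative zx t x) (at x)"
    and zx_cont: "continuous_on ({0..<T} \<times> UNIV) (\<lambda>(t, x). zx t x)"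
    and pde: "\<And>t x. t \<in> {0..<T} \<Longrightarrow> zt t x + zx t x * (a t - b t * x) = 0"
    and terminal: "\<And>x. z T x = 0"
    and t: "t \<in> {0..T}"
  shows "z t x = 0"
proof (cases "t = T")
  case False
  have "continuous_on {0..T} (\<lambda>s. - b s)" by (intro continuous_intros ab)
  then obtain \<phi> where \<phi>t: "\<phi> t = x"
    and \<phi>: "\<And>s. s \<in> {0..T} \<Longrightarrow> (\<phi> has_real_derivative - b s * \<phi> s + a s) (at s within {0..T})"
    by (rule linear_ode_solution[OF _ ab(1) t]) blast
  have \<phi>_cont: "continuous_on {0..T} \<phi>"
    using \<phi> by (meson DERIV_continuous continuous_on_eq_continuous_within)
  have "z T (\<phi> T) = z t (\<phi> t)"
  proof (rule DERIV_isconst_end[of t T "\<lambda>s. z s (\<phi> s)"])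
    show "t < T" using t False by simp
    show "continuous_on {t..T} (\<lambda>s. z s (\<phi> s))"
      by (rule continuous_on_compose2[OF cont, of _ "\<lambda>s. (s, \<phi> s)", simplified])
        (use t in \<open>auto intro!: continuous_intros continuous_on_subset[OF \<phi>_cont]\<close>)
    fix s assume s: "t < s" "s < T"
    have s': "s \<in> {0..<T}" using s t by auto
    \<comment> \<open>Continuity of the space derivative turns the two partial derivatives into a total one, as the
      chain rule requires.\<close>
    let ?D = "\<lambda>(dt, dx). dt * zt s (\<phi> s) + blinfun_apply (blinfun_mult_right (zx s (\<phi> s))) dx"
    have "((\<lambda>(r, y). z r y) has_derivative ?D) (at (s, \<phi> s) within {0..<T} \<times> UNIV)"
    proof (rule has_derivative_partialsI)
      show "((\<lambda>r. z r (\<phi> s)) has_derivative (\<lambda>dt. dt * zt s (\<phi> s))) (at s within {0..<T})"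
        using DERIV_subset[OF zt[OF s', of "\<phi> s"], of "{0..<T}"]
        by (simp add: has_field_derivative_def mult_commute_abs subset_iff)
      show "(z r has_derivative blinfun_apply (blinfun_mult_right (zx r y))) (at y within UNIV)"
        if "r \<in> {0..<T}" for r y
        using zx[OF that, of y] by (simp add: has_field_derivative_def)
      have "continuous_on ({0..<T} \<times> UNIV) (\<lambda>u. blinfun_mult_right (zx (fst u) (snd u)) :: real \<Rightarrow>\<^sub>L real)"
        using zx_cont
        by (intro bounded_linear.continuous_on[OF bounded_linear_blinfun_mult_right])
          (simp add: case_prod_beta')
      then show "continuous (at (s, \<phi> s) within {0..<T} \<times> UNIV) (\<lambda>(r, y). blinfun_mult_right (zx r y) :: real \<Rightarrow>\<^sub>L real)"
        using s' by (simp add: continuous_on_eq_continuous_within case_prod_beta')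
    qed auto
    then have outer: "((\<lambda>(r, y). z r y) has_derivative ?D) (at (s, \<phi> s) within (\<lambda>s. (s, \<phi> s)) ` {0..<T})"
      by (rule has_derivative_subset) auto
    have inner: "((\<lambda>s. (s, \<phi> s)) has_derivative (\<lambda>d. (d, d * (- b s * \<phi> s + a s)))) (at s within {0..<T})"
      using DERIV_subset[OF \<phi>[of s], of "{0..<T}"] s'
      by (intro has_derivative_Pair has_derivative_ident)
        (simp add: has_field_derivative_def mult_commute_abs subset_iff)
    have "((\<lambda>s. z s (\<phi> s)) has_derivative (\<lambda>d. ?D (d, d * (- b s * \<phi> s + a s)))) (at s within {0..<T})"
      using has_derivative_in_compose[OF inner outer] by simp
    moreover have "(\<lambda>d. ?D (d, d * (- b s * \<phi> s + a s))) = (*) 0"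
    proof
      fix d
      have "?D (d, d * (- b s * \<phi> s + a s)) = d * (zt s (\<phi> s) + zx s (\<phi> s) * (a s - b s * \<phi> s))"
        by (simp add: algebra_simps)
      then show "?D (d, d * (- b s * \<phi> s + a s)) = 0 * d" using pde[OF s'] by simp
    qed
    ultimately have "((\<lambda>s. z s (\<phi> s)) has_real_derivative 0) (at s within {0..<T})"
      by (simp add: has_field_derivative_def)
    moreover have "at s within {0..<T} = at s"
      using s t by (intro at_within_interior) auto
    ultimately show "((\<lambda>s. z s (\<phi> s)) has_real_derivative 0) (at s)" by simp
  qed
  then show ?thesis using terminal \<phi>t by simp
qed (use terminal in simp)

section \<open>The valuation equation\<close>

text \<open>
  Collecting powers of \<open>x\<close> in the equation for an affine function gives exactly the two differential
  equations for \<open>A\<close> and \<open>B\<close>; the second-order term vanishes.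
\<close>

lemma affine_solution_satisfies_pde:
  fixes A B q p :: "real \<Rightarrow> real" and V :: "real \<Rightarrow> real \<Rightarrow> real"
  assumes B: "\<And>s. s \<in> {0..T} \<Longrightarrow> (B has_real_derivative
      \<delta>' * B s - (l1 + 2 * q s) + (l1 + 2 * q s) * B s) (at s within {0..T})"
    and A: "\<And>s. s \<in> {0..T} \<Longrightarrow> (A has_real_derivative
      \<delta>' * A s - (l0 + p s) - (c - l0 - p s) * B s) (at s within {0..T})"
    and terminal: "A T = 0" "B T = 0" and T: "0 \<le> T"
    and V: "\<And>t x. t \<in> {0..T} \<Longrightarrow> V t x = A t + B t * x"
  shows "satisfies_pde T \<delta>' c \<sigma> l0 l1 q p V"
  unfolding satisfies_pde_def
proof (intro conjI ballI allI)
  show "V T x = 0" for x using V[of T x] T terminal by simp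
  fix t x assume t: "t \<in> {0..<T}"
  then have t': "t \<in> {0..T}" "0 < T" by auto
  let ?A = "\<delta>' * A t - (l0 + p t) - (c - l0 - p t) * B t"
  let ?B = "\<delta>' * B t - (l1 + 2 * q t) + (l1 + 2 * q t) * B t"
  have "((\<lambda>s. A s + B s * x) has_real_derivative ?A + ?B * x) (at t within {0..T})"
    by (auto intro!: derivative_eq_intros A[OF t'(1)] B[OF t'(1)])
  then have "((\<lambda>s. V s x) has_vector_derivative ?A + ?B * x) (at t within {0..T})"
    unfolding has_real_derivative_iff_has_vector_derivative
    by (rule has_vector_derivative_transform[OF t'(1), rotated]) (simp add: V)
  then have Dt: "D_t T V t x = ?A + ?B * x"
    unfolding D_t_def by (rule vector_derivative_within_closed_interval[OF t'(2,1)])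
  have "V t = (\<lambda>y. A t + B t * y)" using V[OF t'(1)] by auto
  then have Dx: "D_x V t = (\<lambda>y. B t)"
    unfolding D_x_def by (auto intro!: DERIV_imp_deriv derivative_eq_intros)
  have Dxx: "D_xx V t x = 0" by (simp add: D_xx_def Dx)
  show "D_t T V t x = \<delta>' * V t x - l0 - p t - (l1 + 2 * q t) * x
      - D_x V t x * (c - l0 - p t - (l1 + 2 * q t) * x) - 1 / 2 * D_xx V t x * \<sigma>\<^sup>2"
    by (simp add: Dt Dx Dxx V[OF t'(1)] algebra_simps)
qed

lemma C12_derivatives:
  assumes v: "C12 T v" and t: "t \<in> {0..<T}"
  shows "((\<lambda>s. v s x) has_real_derivative D_t T v t x) (at t within {0..T})"
    and "(v t has_real_derivative D_x v t x) (at x)"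
    and "(D_x v t has_real_derivative D_xx v t x) (at x)"
proof -
  show "((\<lambda>s. v s x) has_real_derivative D_t T v t x) (at t within {0..T})"
    using v t unfolding C12_def D_t_def has_real_derivative_iff_has_vector_derivative
    by (subst vector_derivative_works[symmetric]) auto
  show "(v t has_real_derivative D_x v t x) (at x)"
    "(D_x v t has_real_derivative D_xx v t x) (at x)"
    using v t unfolding C12_def D_x_def[of v t x] D_xx_def DERIV_deriv_iff_real_differentiable by auto
qed

text \<open>
  The difference of \<open>v\<close> and the affine solution solves the homogeneous equation with zero terminal value.
  The factor \<open>exp (- \<delta>' t)\<close> removes the zero-order term, whose sign is arbitrary and would otherwise
  break the maximum principle. The affine part grows slower than \<open>exp (x\<^sup>2)\<close>, so the difference inherits
  a Gaussian growth bound from \<open>v\<close>.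
\<close>

lemma pde_solution_eq_affine:
  fixes A B q p :: "real \<Rightarrow> real"
  assumes q: "continuous_on {0..T} q" and p: "continuous_on {0..T} p"
    and B: "\<And>s. s \<in> {0..T} \<Longrightarrow> (B has_real_derivative
      \<delta>' * B s - (l1 + 2 * q s) + (l1 + 2 * q s) * B s) (at s within {0..T})"
    and A: "\<And>s. s \<in> {0..T} \<Longrightarrow> (A has_real_derivative
      \<delta>' * A s - (l0 + p s) - (c - l0 - p s) * B s) (at s within {0..T})"
    and terminal: "A T = 0" "B T = 0"
    and v: "C12 T v" and growth: "tychonoff_class T \<sigma> v"
    and pde: "satisfies_pde T \<delta>' c \<sigma> l0 l1 q p v"
    and t: "t \<in> {0..T}"
  shows "v t x = A t + B t * x"
proof -
  define a where "a s = c - l0 - p s" for s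
  define b where "b s = l1 + 2 * q s" for s
  define z where "z t x = exp (- \<delta>' * t) * (v t x - (A t + B t * x))" for t x
  define zt where "zt t x = exp (- \<delta>' * t) * (D_t T v t x
      - ((\<delta>' * A t - (l0 + p t) - a t * B t) + (\<delta>' * B t - b t + b t * B t) * x)
      - \<delta>' * (v t x - (A t + B t * x)))" for t x
  define zx where "zx t x = exp (- \<delta>' * t) * (D_x v t x - B t)" for t x
  define zxx where "zxx t x = exp (- \<delta>' * t) * D_xx v t x" for t x
  have a: "continuous_on {0..T} a" and b: "continuous_on {0..T} b"
    unfolding a_def b_def by (intro continuous_intros p q)+
  have Ac: "continuous_on {0..T} A" and Bc: "continuous_on {0..T} B"
    using A B by (meson DERIV_continuous continuous_on_eq_continuous_within)+
  have lift: "continuous_on (S \<times> UNIV) (\<lambda>u. f (fst u))"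
    if "continuous_on {0..T} f" "S \<subseteq> {0..T}" for f :: "real \<Rightarrow> real" and S
    by (rule continuous_on_compose2[OF that(1)]) (use that(2) in \<open>auto intro!: continuous_intros\<close>)
  have z_cont: "continuous_on ({0..T} \<times> UNIV) (\<lambda>(t, x). z t x)"
    using v unfolding C12_def z_def case_prod_beta'
    by (intro continuous_intros lift Ac Bc) auto
  have zx_cont: "continuous_on ({0..<T} \<times> UNIV) (\<lambda>(t, x). zx t x)"
    using v unfolding C12_def zx_def case_prod_beta'
    by (intro continuous_intros lift Bc) auto
  have zt: "((\<lambda>s. z s x) has_real_derivative zt t x) (at t within {0..T})" if t: "t \<in> {0..<T}" for t x
  proof -
    have t': "t \<in> {0..T}" using t by simp
    show ?thesis unfolding z_def zt_def a_def b_def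
      by (auto intro!: derivative_eq_intros A[OF t'] B[OF t'] C12_derivatives(1)[OF v t] simp: algebra_simps)
  qed
  have zx: "(z t has_real_derivative zx t x) (at x)" if t: "t \<in> {0..<T}" for t x
    unfolding z_def[abs_def] zx_def
    by (auto intro!: derivative_eq_intros C12_derivatives(2)[OF v t])
  have zxx: "(zx t has_real_derivative zxx t x) (at x)" if t: "t \<in> {0..<T}" for t x
    unfolding zx_def[abs_def] zxx_def
    by (auto intro!: derivative_eq_intros C12_derivatives(3)[OF v t])
  have z_pde: "zt t x + zx t x * (a t - b t * x) + 1 / 2 * zxx t x * \<sigma>\<^sup>2 = 0"
    if t: "t \<in> {0..<T}" for t x
  proof -
    have Dt: "D_t T v t x = \<delta>' * v t x - l0 - p t - b t * x
        - D_x v t x * (a t - b t * x) - 1 / 2 * D_xx v t x * \<sigma>\<^sup>2"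
      using pde t by (simp add: satisfies_pde_def a_def b_def)
    show ?thesis unfolding zt_def zx_def zxx_def Dt by (simp add: algebra_simps)
  qed
  have z_T: "z T x = 0" for x
    using pde terminal by (simp add: z_def satisfies_pde_def)
  have "z t x = 0"
  proof (cases "\<sigma> = 0")
    case True
    then show ?thesis
      using transport_uniqueness[OF a b z_cont zt zx zx_cont _ z_T t] z_pde by simp
  next
    case False
    then obtain C \<alpha> where g: "\<And>t x. t \<in> {0..T} \<Longrightarrow> \<bar>v t x\<bar> \<le> C * exp (\<alpha> * x\<^sup>2)"
      using growth unfolding tychonoff_class_def by blast
    obtain HA where HA: "\<And>s. s \<in> {0..T} \<Longrightarrow> \<bar>A s\<bar> \<le> HA"
      using continuous_on_compact_bound[OF compact_Icc Ac] by auto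
    obtain HB where HB: "\<And>s. s \<in> {0..T} \<Longrightarrow> \<bar>B s\<bar> \<le> HB"
      using continuous_on_compact_bound[OF compact_Icc Bc] by auto
    have "continuous_on {0..T} (\<lambda>s. exp (- \<delta>' * s))" by (intro continuous_intros)
    then obtain HE where HE: "\<And>s. s \<in> {0..T} \<Longrightarrow> exp (- \<delta>' * s) \<le> HE"
      using continuous_on_compact_bound[OF compact_Icc] by (metis abs_of_pos exp_gt_zero real_norm_def)
    define \<beta> where "\<beta> = max \<alpha> 1"
    define D where "D = HE * (\<bar>C\<bar> + HA + HB) + 1"
    have H0: "0 \<le> HA" "0 \<le> HB" "0 < HE"
      using HA[OF t] HB[OF t] HE[OF t] exp_gt_zero[of "- \<delta>' * t"] by linarith+
    have "\<bar>z s y\<bar> \<le> D * exp (\<beta> * y\<^sup>2)" if s: "s \<in> {0..T}" for s y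
    proof -
      have E1: "1 + y\<^sup>2 \<le> exp (\<beta> * y\<^sup>2)"
      proof -
        have "1 + y\<^sup>2 \<le> exp (y\<^sup>2)" by (rule exp_ge_add_one_self)
        also have "\<dots> \<le> exp (\<beta> * y\<^sup>2)"
          using mult_right_mono[of 1 \<beta> "y\<^sup>2"] by (simp add: \<beta>_def)
        finally show ?thesis .
      qed
      have "\<bar>v s y\<bar> \<le> C * exp (\<alpha> * y\<^sup>2)" by (rule g[OF s])
      also have "\<dots> \<le> \<bar>C\<bar> * exp (\<beta> * y\<^sup>2)"
        by (intro mult_mono) (auto simp: \<beta>_def intro!: mult_right_mono)
      finally have v1: "\<bar>v s y\<bar> \<le> \<bar>C\<bar> * exp (\<beta> * y\<^sup>2)" .
      have "1 \<le> exp (\<beta> * y\<^sup>2)" using E1 zero_le_power2[of y] by linarith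
      then have A1: "\<bar>A s\<bar> \<le> HA * exp (\<beta> * y\<^sup>2)"
        using HA[OF s] H0(1) by (metis mult.right_neutral mult_left_mono order_trans)
      have "\<bar>y\<bar> \<le> 1 + y\<^sup>2"
        using sum_squares_bound[of 1 "\<bar>y\<bar>"] by simp
      then have "\<bar>B s * y\<bar> \<le> HB * exp (\<beta> * y\<^sup>2)"
        unfolding abs_mult using HB[OF s] H0(2) E1 by (intro mult_mono) auto
      then have "\<bar>v s y - (A s + B s * y)\<bar> \<le> (\<bar>C\<bar> + HA + HB) * exp (\<beta> * y\<^sup>2)"
        using v1 A1 unfolding distrib_right by linarith
      then have "\<bar>z s y\<bar> \<le> HE * ((\<bar>C\<bar> + HA + HB) * exp (\<beta> * y\<^sup>2))"
        unfolding z_def abs_mult using HE[OF s] H0 by (intro mult_mono) auto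
      also have "\<dots> \<le> D * exp (\<beta> * y\<^sup>2)" by (simp add: D_def algebra_simps)
      finally show ?thesis .
    qed
    moreover have "0 < \<beta>" "0 < D" using H0 by (auto simp: \<beta>_def D_def intro!: add_nonneg_pos)
    ultimately show ?thesis
      using tychonoff_uniqueness[OF _ _ a b z_cont zt zx zxx z_pde z_T _ t] by blast
  qed
  then show ?thesis by (simp add: z_def)
qed

theorem proposition4p1:
  fixes T c \<sigma> \<delta> \<delta>' \<kappa> xT l0 l1 x0 \<Delta>\<Gamma> :: real
    and \<tau> :: nat
    and \<gamma> q p :: "real \<Rightarrow> real"
    and M :: "'a measure"
    and W :: "real \<Rightarrow> 'a \<Rightarrow> real"
    and X :: "real \<Rightarrow> real \<Rightarrow> real \<Rightarrow> 'a \<Rightarrow> real"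
  assumes "0 \<le> T" and "0 \<le> \<Delta>\<Gamma>" and "\<tau> \<in> {0, 1, 2}"
    and "brownian_motion M W"
    and q_ode: "\<forall>t\<in>{0..T}.
      (q has_real_derivative \<delta> * q t + 2 * (q t)\<^sup>2 - 1 / 2 * \<gamma> t + 2 * q t * l1) (at t within {0..T})"
    and p_ode: "\<forall>t\<in>{0..T}.
      (p has_real_derivative
         \<delta> * p t + \<gamma> t * x0 - 2 * q t * c + 2 * q t * l0 + p t * l1 + 2 * q t * p t) (at t within {0..T})"
    and terminal0: "\<tau> = 0 \<longrightarrow> q T = \<Delta>\<Gamma> \<and> p T = - 2 * \<Delta>\<Gamma> * x0"
    and terminal1: "\<tau> = 1 \<longrightarrow> q T = \<Delta>\<Gamma> \<and> p T = - 2 * \<Delta>\<Gamma> * x0 + \<kappa>"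
    and terminal2: "\<tau> = 2 \<longrightarrow> q T = \<Delta>\<Gamma> + \<kappa> \<and> p T = - 2 * \<Delta>\<Gamma> * x0 - 2 * \<kappa> * xT"
    and surplus: "\<forall>t\<in>{0..T}. \<forall>x. surplus_solution M W T c \<sigma> l0 l1 q p t x (X t x)"
  shows "(C12 T (VLQ M X T \<delta>' l0 l1 q p) \<longrightarrow>
            satisfies_pde T \<delta>' c \<sigma> l0 l1 q p (VLQ M X T \<delta>' l0 l1 q p)) \<and>
         (\<forall>v. C12 T v \<and> tychonoff_class T \<sigma> v \<and> satisfies_pde T \<delta>' c \<sigma> l0 l1 q p v \<longrightarrow>
            (\<forall>t\<in>{0..T}. \<forall>x. v t x = VLQ M X T \<delta>' l0 l1 q p t x))"
proof -
  have q: "continuous_on {0..T} q" and p: "continuous_on {0..T} p"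
    using q_ode p_ode by (meson DERIV_continuous continuous_on_eq_continuous_within)+
  have T: "T \<in> {0..T}" using \<open>0 \<le> T\<close> by simp
  have "continuous_on {0..T} (\<lambda>s. \<delta>' + (l1 + 2 * q s))" "continuous_on {0..T} (\<lambda>s. - (l1 + 2 * q s))"
    by (intro continuous_intros q)+
  then obtain B where B_T: "B T = 0" and B: "\<And>s. s \<in> {0..T} \<Longrightarrow>
      (B has_real_derivative (\<delta>' + (l1 + 2 * q s)) * B s + - (l1 + 2 * q s)) (at s within {0..T})"
    by (rule linear_ode_solution[OF _ _ T]) blast
  have B': "(B has_real_derivative \<delta>' * B s - (l1 + 2 * q s) + (l1 + 2 * q s) * B s) (at s within {0..T})"
    if "s \<in> {0..T}" for s
    using B[OF that] by (simp add: algebra_simps)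
  have Bc: "continuous_on {0..T} B"
    using B by (meson DERIV_continuous continuous_on_eq_continuous_within)
  have "continuous_on {0..T} (\<lambda>s. \<delta>')" "continuous_on {0..T} (\<lambda>s. - (l0 + p s) - (c - l0 - p s) * B s)"
    by (intro continuous_intros p Bc)+
  then obtain A where A_T: "A T = 0" and A: "\<And>s. s \<in> {0..T} \<Longrightarrow>
      (A has_real_derivative \<delta>' * A s + (- (l0 + p s) - (c - l0 - p s) * B s)) (at s within {0..T})"
    by (rule linear_ode_solution[OF _ _ T]) blast
  have A': "(A has_real_derivative \<delta>' * A s - (l0 + p s) - (c - l0 - p s) * B s) (at s within {0..T})"
    if "s \<in> {0..T}" for s
    using A[OF that] by (simp add: algebra_simps)
  have V: "VLQ M X T \<delta>' l0 l1 q p t x = A t + B t * x" if t: "t \<in> {0..T}" for t x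
  proof (rule expected_dividends_affine[OF \<open>brownian_motion M W\<close>])
    have sub: "{t..T} \<subseteq> {0..T}" using t by auto
    show "continuous_on {t..T} q" "continuous_on {t..T} p"
      using q p sub by (auto intro: continuous_on_subset)
    show "surplus_solution M W T c \<sigma> l0 l1 q p t x (X t x)" using surplus t by blast
    fix s assume "s \<in> {t..T}"
    then have s: "s \<in> {0..T}" using sub by blast
    show "(B has_real_derivative \<delta>' * B s - (l1 + 2 * q s) + (l1 + 2 * q s) * B s) (at s within {t..T})"
      by (rule DERIV_subset[OF B'[OF s] sub])
    show "(A has_real_derivative \<delta>' * A s - (l0 + p s) - (c - l0 - p s) * B s) (at s within {t..T})"
      by (rule DERIV_subset[OF A'[OF s] sub])
  qed (use t A_T B_T in auto)
  show ?thesis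
  proof (intro conjI impI allI ballI)
    show "satisfies_pde T \<delta>' c \<sigma> l0 l1 q p (VLQ M X T \<delta>' l0 l1 q p)"
      by (rule affine_solution_satisfies_pde[OF B' A' A_T B_T \<open>0 \<le> T\<close> V])
    fix v t x
    assume v: "C12 T v \<and> tychonoff_class T \<sigma> v \<and> satisfies_pde T \<delta>' c \<sigma> l0 l1 q p v"
      and t: "t \<in> {0..T}"
    have "v t x = A t + B t * x"
      using pde_solution_eq_affine[OF q p B' A' A_T B_T _ _ _ t] v by blast
    then show "v t x = VLQ M X T \<delta>' l0 l1 q p t x" using V[OF t] by simp
  qed
qed

end
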